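(* For any topologically reasonable pointclass $\Gamma$, $\Gamma(\mathbb{D})$ implies $\Gamma(\mathbb{L})$.
   Context: The dominating topology $\mathcal{D}$ on $\omega^\omega$ has as base the sets $[N,f]=\{x\in\omega^\omega: f{\restriction}N\subseteq x,\ x(n)\ge f(n)\text{ for all }n\}$ ($N\in\omega$, $f\in\omega^\omega$). $\Gamma(\mathbb{D})$ means every set in $\Gamma$ has the Baire property in $\mathcal{D}$. A Laver tree is a tree $L\subseteq\omega^{<\omega}$ all of whose nodes extending the stem have infinitely many immediate successors; $\mathbb{L}$ is the set of Laver trees ordered by inclusion; $[T]$ is the set of branches of $T$. $A\subseteq\omega^\omega$ is $\mathbb{L}$-measurable if for every $L\in\mathbb{L}$ there is a Laver tree $L'\subseteq L$ with $[L']\subseteq A$ or $[L']\cap A=\emptyset$; $\Gamma(\mathbb{L})$ means every set in $\Gamma$ is $\mathbb{L}$-measurable. A pointclass $\Gamma$ is topologically reasonable if it is closed under continuous preimages and $A\cap Q\in\Gamma$ whenever $A\in\Gamma$ and $Q$ is closed. *)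

theory Defs
  imports "HOL-Analysis.Analysis" "HOL-Library.Sublist"
begin

(* Baire space \<omega>^\<omega> is the type nat \<Rightarrow> nat with the library's product topology
   (nat carries the discrete topology); this is the usual Baire-space topology. *)

definition dom_basic :: "nat \<Rightarrow> (nat \<Rightarrow> nat) \<Rightarrow> (nat \<Rightarrow> nat) set" where
  "dom_basic N f = {x. (\<forall>n<N. x n = f n) \<and> (\<forall>n. x n \<ge> f n)}"

definition dominating_topology :: "(nat \<Rightarrow> nat) topology" where
  "dominating_topology = topology_generated_by {dom_basic N f | N f. True}"

definition nowhere_dense_in :: "'a topology \<Rightarrow> 'a set \<Rightarrow> bool" where
  "nowhere_dense_in T S \<longleftrightarrow> S \<subseteq> topspace T \<and> T interior_of (T closure_of S) = {}"

definition meager_in :: "'a topology \<Rightarrow> 'a set \<Rightarrow> bool" where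
  "meager_in T S \<longleftrightarrow> (\<exists>F. countable F \<and> (\<forall>N\<in>F. nowhere_dense_in T N) \<and> S \<subseteq> \<Union>F)"

definition baire_property_in :: "'a topology \<Rightarrow> 'a set \<Rightarrow> bool" where
  "baire_property_in T A \<longleftrightarrow> (\<exists>U. openin T U \<and> meager_in T ((A - U) \<union> (U - A)))"

definition is_tree :: "nat list set \<Rightarrow> bool" where
  "is_tree T \<longleftrightarrow> T \<noteq> {} \<and> (\<forall>t\<in>T. \<forall>s. prefix s t \<longrightarrow> s \<in> T)"

definition laver_tree_stem :: "nat list set \<Rightarrow> nat list \<Rightarrow> bool" where
  "laver_tree_stem L s \<longleftrightarrow> is_tree L \<and> s \<in> L \<and>
     (\<forall>t\<in>L. prefix t s \<or> prefix s t) \<and>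
     (\<forall>t\<in>L. prefix s t \<longrightarrow> infinite {n. t @ [n] \<in> L})"

definition laver_tree :: "nat list set \<Rightarrow> bool" where
  "laver_tree L \<longleftrightarrow> (\<exists>s. laver_tree_stem L s)"

definition branches :: "nat list set \<Rightarrow> (nat \<Rightarrow> nat) set" where
  "branches T = {x. \<forall>n. map x [0..<n] \<in> T}"

definition laver_measurable :: "(nat \<Rightarrow> nat) set \<Rightarrow> bool" where
  "laver_measurable A \<longleftrightarrow> (\<forall>L. laver_tree L \<longrightarrow>
     (\<exists>L'. laver_tree L' \<and> L' \<subseteq> L \<and> (branches L' \<subseteq> A \<or> branches L' \<inter> A = {})))"

definition topologically_reasonable :: "(nat \<Rightarrow> nat) set set \<Rightarrow> bool" where
  "topologically_reasonable \<Gamma> \<longleftrightarrow>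
     (\<forall>A\<in>\<Gamma>. \<forall>f :: (nat \<Rightarrow> nat) \<Rightarrow> (nat \<Rightarrow> nat). continuous_on UNIV f \<longrightarrow> f -` A \<in> \<Gamma>) \<and>
     (\<forall>A\<in>\<Gamma>. \<forall>Q. closed Q \<longrightarrow> A \<inter> Q \<in> \<Gamma>)"

end

(* Code branches of a Laver tree L by points x, letting x (to_nat t) select the successor of the node t.
   This coding is continuous, so the preimage of A is decided, up to a meager set, on some basic set
   of the dominating topology. It remains to find a Laver subtree of L whose branches are all coded by
   points avoiding countably many nowhere dense sets. For each of these sets a rank in the style of
   Baumgartner and Dordal on finite partial functions tells how to meet its complement: a stem of
   positive rank has extensions of smaller rank on one fixed finite set of coordinates, with
   values tending to infinity. When that finite set contains the coordinate of the current node,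
   these extensions select infinitely many different successors; all other coordinates are harmless. *)

theory Submission
  imports Defs
begin

section \<open>Cylinders of finite partial functions\<close>

text \<open>Stems may have gaps, as a walk reads coordinates in no fixed order; \<open>f\<close> is
  ignored on \<open>dom p\<close>.\<close>

definition cyl :: "(nat \<rightharpoonup> nat) \<Rightarrow> (nat \<Rightarrow> nat) \<Rightarrow> (nat \<Rightarrow> nat) set" where
  "cyl p f = {x. \<forall>n. case p n of None \<Rightarrow> f n \<le> x n | Some v \<Rightarrow> x n = v}"

text \<open>With \<open>f \<le> g\<close> added, this is the order of Hechler forcing on conditions
  \<open>(p, f)\<close> and \<open>(q, g)\<close> whose stems are partial functions.\<close>

definition extends_above :: "(nat \<Rightarrow> nat) \<Rightarrow> (nat \<rightharpoonup> nat) \<Rightarrow> (nat \<rightharpoonup> nat) \<Rightarrow> bool" where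
  "extends_above f p q \<longleftrightarrow> p \<subseteq>\<^sub>m q \<and> (\<forall>n v. p n = None \<longrightarrow> q n = Some v \<longrightarrow> f n \<le> v)"

lemma extends_above_refl: "extends_above f p p"
  by (simp add: extends_above_def)

lemma extends_above_trans:
  assumes "extends_above f p q" "extends_above g q r" "f \<le> g"
  shows "extends_above f p r"
  unfolding extends_above_def
proof (intro conjI allI impI)
  show "p \<subseteq>\<^sub>m r"
    using assms map_le_trans unfolding extends_above_def by blast
next
  fix n v assume p: "p n = None" and r: "r n = Some v"
  show "f n \<le> v"
  proof (cases "q n")
    case None
    then have "g n \<le> v" using assms(2) r by (simp add: extends_above_def)
    then show ?thesis using assms(3) le_funD[of f g n] by linarith
  next
    case (Some w)
    then have "r n = Some w" using assms(2) by (metis domI extends_above_def map_le_def)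
    then show ?thesis using assms(1) p Some r by (auto simp: extends_above_def)
  qed
qed

lemma cyl_antimono:
  assumes "extends_above f p q" "f \<le> g"
  shows "cyl q g \<subseteq> cyl p f"
proof
  fix x assume x: "x \<in> cyl q g"
  have "case p n of None \<Rightarrow> f n \<le> x n | Some v \<Rightarrow> x n = v" for n
  proof (cases "p n")
    case None
    show ?thesis
    proof (cases "q n")
      case None
      then have "g n \<le> x n" using x by (force simp: cyl_def dest: spec[of _ n])
      then show ?thesis using \<open>p n = None\<close> le_funD[OF assms(2), of n] by simp
    next
      case (Some v)
      then have "x n = v" using x by (force simp: cyl_def dest: spec[of _ n])
      then show ?thesis using \<open>p n = None\<close> Some assms(1) by (auto simp: extends_above_def)
    qed
  next
    case (Some v)
    then have "q n = Some v" using assms(1) by (metis domI extends_above_def map_le_def)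
    then have "x n = v" using x by (force simp: cyl_def dest: spec[of _ n])
    then show ?thesis using Some by simp
  qed
  then show "x \<in> cyl p f" by (simp add: cyl_def)
qed

definition initial_map :: "(nat \<Rightarrow> nat) \<Rightarrow> nat \<Rightarrow> (nat \<rightharpoonup> nat)" where
  "initial_map x N = (\<lambda>n. if n < N then Some (x n) else None)"

lemma dom_initial_map [simp]: "dom (initial_map x N) = {..<N}"
  by (auto simp: initial_map_def dom_def)

lemma dom_basic_eq_cyl: "dom_basic N f = cyl (initial_map f N) f"
proof -
  have "x \<in> dom_basic N f \<longleftrightarrow> (\<forall>n. if n < N then x n = f n else f n \<le> x n)" for x
    unfolding dom_basic_def mem_Collect_eq by (metis order_refl)
  moreover have "x \<in> cyl (initial_map f N) f \<longleftrightarrow> (\<forall>n. if n < N then x n = f n else f n \<le> x n)" for x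
    unfolding cyl_def initial_map_def mem_Collect_eq by (rule all_cong1) simp
  ultimately show ?thesis by blast
qed

lemma extends_above_initial_map:
  assumes "x \<in> cyl p f" "dom p \<subseteq> {..<N}"
  shows "extends_above f p (initial_map x N)"
proof -
  have *: "case p n of None \<Rightarrow> f n \<le> x n | Some v \<Rightarrow> x n = v" for n
    using assms(1) by (simp add: cyl_def)
  have "p n = initial_map x N n" if "n \<in> dom p" for n
    using that *[of n] assms(2) by (auto simp: initial_map_def)
  moreover have "f n \<le> v" if "p n = None" "initial_map x N n = Some v" for n v
    using that *[of n] by (auto simp: initial_map_def split: if_splits)
  ultimately show ?thesis unfolding extends_above_def map_le_def by blast
qed

section \<open>The dominating topology\<close>

lemma openin_dom_basic: "openin dominating_topology (dom_basic N f)"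
  unfolding dominating_topology_def by (rule topology_generated_by_Basis) blast

lemma dom_basic_self: "f \<in> dom_basic N f"
  by (simp add: dom_basic_def)

lemma topspace_dominating: "topspace dominating_topology = UNIV"
  unfolding dominating_topology_def topology_generated_by_topspace
  using dom_basic_self by blast

text \<open>The generating sets are only a subbase by definition; they form a base since around each
  point of an intersection of two of them there is a third.\<close>

lemma openin_dominatingE:
  assumes "openin dominating_topology U" "x \<in> U"
  obtains N f where "x \<in> dom_basic N f" "dom_basic N f \<subseteq> U"
proof -
  have "generate_topology_on {dom_basic N f | N f. True} U"
    using assms(1) by (simp add: dominating_topology_def openin_topology_generated_by_iff)
  then have "\<forall>x\<in>U. \<exists>N f. x \<in> dom_basic N f \<and> dom_basic N f \<subseteq> U"
  proof (induction rule: generate_topology_on.induct)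
    case (Int a b)
    show ?case
    proof
      fix x assume "x \<in> a \<inter> b"
      then obtain N f M g where 1: "x \<in> dom_basic N f" "dom_basic N f \<subseteq> a"
        and 2: "x \<in> dom_basic M g" "dom_basic M g \<subseteq> b"
        using Int.IH by blast
      \<comment> \<open>Below both lengths the bound is \<open>x\<close> itself, which dominates
        \<open>f\<close> and \<open>g\<close>, so that one function serves as stem and as
        bound.\<close>
      define k where "k n = (if n < max N M then x n else max (f n) (g n))" for n
      have "x \<in> dom_basic (max N M) k"
        using 1(1) 2(1) by (auto simp: dom_basic_def k_def)
      moreover have "dom_basic (max N M) k \<subseteq> dom_basic N f"
      proof
        fix z assume z: "z \<in> dom_basic (max N M) k"
        have "z n = f n" if "n < N" for n
          using that z 1(1) by (auto simp: dom_basic_def k_def)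
        moreover have "f n \<le> z n" for n
        proof -
          have "k n \<le> z n" using z by (simp add: dom_basic_def)
          moreover have "f n \<le> k n" using 1(1) by (simp add: dom_basic_def k_def)
          ultimately show ?thesis by linarith
        qed
        ultimately show "z \<in> dom_basic N f" by (simp add: dom_basic_def)
      qed
      moreover have "dom_basic (max N M) k \<subseteq> dom_basic M g"
      proof
        fix z assume z: "z \<in> dom_basic (max N M) k"
        have "z n = g n" if "n < M" for n
          using that z 2(1) by (auto simp: dom_basic_def k_def)
        moreover have "g n \<le> z n" for n
        proof -
          have "k n \<le> z n" using z by (simp add: dom_basic_def)
          moreover have "g n \<le> k n" using 2(1) by (simp add: dom_basic_def k_def)
          ultimately show ?thesis by linarith
        qed
        ultimately show "z \<in> dom_basic M g" by (simp add: dom_basic_def)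
      qed
      ultimately show "\<exists>N f. x \<in> dom_basic N f \<and> dom_basic N f \<subseteq> a \<inter> b"
        using 1(2) 2(2) by blast
    qed
  qed blast+
  then show thesis using assms(2) that by blast
qed

text \<open>A basic set inside \<open>cyl p f\<close> contains another that misses the closure of
  \<open>S\<close>; its stem can then be prolonged to cover \<open>{..<j}\<close>.\<close>

lemma nowhere_dense_avoid:
  assumes S: "nowhere_dense_in dominating_topology S" and "finite (dom p)"
  shows "\<exists>q g. finite (dom q) \<and> extends_above f p q \<and> {..<j} \<subseteq> dom q \<and> cyl q g \<inter> S = {}"
proof -
  let ?D = dominating_topology
  obtain N where N: "dom p \<subseteq> {..<N}"
    using finite_nat_bounded[OF assms(2)] by auto
  \<comment> \<open>The least point of \<open>cyl p f\<close>; its initial segment of length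
    \<open>N\<close> fills the gaps of \<open>p\<close>.\<close>
  define x where "x n = (case p n of None \<Rightarrow> f n | Some v \<Rightarrow> v)" for n
  have sub: "dom_basic N x \<subseteq> cyl p f"
  proof
    fix z assume z: "z \<in> dom_basic N x"
    have "case p n of None \<Rightarrow> f n \<le> z n | Some v \<Rightarrow> z n = v" for n
    proof (cases "p n")
      case None
      then show ?thesis using z by (auto simp: dom_basic_def x_def dest: spec[of _ n])
    next
      case (Some v)
      then have "n < N" using N by auto
      then show ?thesis using z Some by (auto simp: dom_basic_def x_def)
    qed
    then show "z \<in> cyl p f" by (simp add: cyl_def)
  qed
  have "\<not> dom_basic N x \<subseteq> ?D closure_of S"
  proof
    assume "dom_basic N x \<subseteq> ?D closure_of S"
    then have "dom_basic N x \<subseteq> ?D interior_of (?D closure_of S)"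
      by (rule interior_of_maximal[OF _ openin_dom_basic])
    then show False using S dom_basic_self[of x N] by (auto simp: nowhere_dense_in_def)
  qed
  then obtain z where z: "z \<in> dom_basic N x - ?D closure_of S" by blast
  have "openin ?D (dom_basic N x - ?D closure_of S)"
    by (simp add: openin_diff openin_dom_basic)
  then obtain M y where y: "dom_basic M y \<subseteq> dom_basic N x - ?D closure_of S"
    using openin_dominatingE z by metis
  have "S \<subseteq> ?D closure_of S"
    by (simp add: closure_of_subset topspace_dominating)
  with y have disj: "dom_basic M y \<inter> S = {}" by blast
  define K where "K = Max {N, M, j}"
  have K: "N \<le> K" "M \<le> K" "j \<le> K" by (auto simp: K_def)
  have "y \<in> cyl p f" using dom_basic_self y sub by blast
  then have "extends_above f p (initial_map y K)"
    by (rule extends_above_initial_map) (use N K in auto)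
  moreover have "cyl (initial_map y K) y \<subseteq> dom_basic M y"
    unfolding dom_basic_eq_cyl[symmetric] using K by (auto simp: dom_basic_def)
  ultimately show ?thesis
    using disj K by (intro exI[of _ "initial_map y K"] exI[of _ y]) auto
qed

section \<open>Ranks\<close>

text \<open>Well-founded trees serve as ranks instead of ordinals: a node lies above countably many
  ranks without any suprema being formed.\<close>

datatype rank_tree = Leaf | Node "nat \<Rightarrow> rank_tree"

definition immediate_subtree :: "(rank_tree \<times> rank_tree) set" where
  "immediate_subtree = {(T k, Node T) | T k. True}"

lemma wf_immediate_subtree: "wf immediate_subtree"
proof (rule wfUNIVI)
  fix P :: "rank_tree \<Rightarrow> bool" and T
  assume *: "\<forall>T. (\<forall>T'. (T', T) \<in> immediate_subtree \<longrightarrow> P T') \<longrightarrow> P T"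
  show "P T"
  proof (induction T)
    case Leaf
    then show ?case using * by (auto simp: immediate_subtree_def)
  next
    case (Node T)
    then have "P T'" if "(T', Node T) \<in> immediate_subtree" for T'
      using that by (auto simp: immediate_subtree_def)
    then show ?case using * by blast
  qed
qed

text \<open>Stems are finite partial functions rather than finite sequences: since members of
  \<open>\<omega>\<^sup>\<omega>\<close> need not be increasing, some coordinates may have to stay bounded while
  earlier ones tend to infinity, and a rank on sequences would not be total.\<close>

inductive ranked :: "((nat \<rightharpoonup> nat) \<Rightarrow> bool) \<Rightarrow> rank_tree \<Rightarrow> (nat \<rightharpoonup> nat) \<Rightarrow> bool"
  for W where
  leaf: "W p \<Longrightarrow> ranked W Leaf p"
| node: "\<lbrakk>finite E; E \<inter> dom p = {}; \<And>k. dom (u k) = E; \<And>k n v. u k n = Some v \<Longrightarrow> k \<le> v;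
          \<And>k. ranked W (T k) (p ++ u k)\<rbrakk> \<Longrightarrow> ranked W (Node T) p"

text \<open>Otherwise each \<open>k\<close> has a map on \<open>E\<close> with values at least
  \<open>k\<close> that leads to a ranked stem, and by the rule \<open>node\<close> these maps rank
  \<open>p\<close>. The bound still depends on \<open>E\<close>.\<close>

lemma unranked_bound:
  assumes "\<nexists>T. ranked W T p" "finite E" "E \<inter> dom p = {}"
  shows "\<exists>F. \<forall>u. dom u = E \<longrightarrow> (\<forall>n v. u n = Some v \<longrightarrow> F \<le> v) \<longrightarrow> (\<nexists>T. ranked W T (p ++ u))"
proof (rule ccontr)
  assume "\<not> ?thesis"
  then have "\<forall>k. \<exists>u T. dom u = E \<and> (\<forall>n v. u n = Some v \<longrightarrow> k \<le> v) \<and> ranked W T (p ++ u)"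
    by blast
  then obtain u T where "\<And>k. dom (u k) = E" "\<And>k n v. u k n = Some v \<Longrightarrow> k \<le> v"
    "\<And>k. ranked W (T k) (p ++ u k)"
    by metis
  then have "ranked W (Node T) p" using assms(2,3) by (intro ranked.node)
  then show False using assms(1) by blast
qed

section \<open>A uniform bound for unranked stems\<close>

lemma finite_bounded_maps: "finite {v :: nat \<rightharpoonup> nat. dom v \<subseteq> {..<m} \<and> ran v \<subseteq> {..<b}}"
proof -
  have "finite (\<Union>D\<in>Pow {..<m}. {v :: nat \<rightharpoonup> nat. dom v = D \<and> ran v \<subseteq> {..<b}})"
    by (intro finite_UN_I finite_set_of_finite_maps) (auto intro: finite_subset)
  then show ?thesis
    by (rule rev_finite_subset) blast
qed

text \<open>Pigeonhole: \<open>m\<close> values cannot meet \<open>m + 1\<close> disjoint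
  intervals.\<close>

lemma ex_empty_gap:
  fixes b :: "nat \<Rightarrow> nat"
  assumes "mono b" "card A \<le> m" "finite A"
  shows "\<exists>i\<le>m. \<forall>n\<in>A. a n < b i \<or> b (Suc i) \<le> a n"
proof (rule ccontr)
  assume "\<not> ?thesis"
  then have "\<forall>i\<in>{..m}. \<exists>n\<in>A. b i \<le> a n \<and> a n < b (Suc i)" by force
  then obtain c where c: "\<And>i. i \<le> m \<Longrightarrow> c i \<in> A \<and> b i \<le> a (c i) \<and> a (c i) < b (Suc i)"
    by (metis atMost_iff)
  have "inj_on c {..m}"
  proof (rule linorder_inj_onI)
    fix i i' assume "i < i'" "i \<in> {..m}" "i' \<in> {..m}"
    then have "a (c i) < b (Suc i)" "b i' \<le> a (c i')" "b (Suc i) \<le> b i'"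
      using c assms(1) by (auto simp: mono_def)
    then show "c i \<noteq> c i'" by force
  qed auto
  then have "card {..m} \<le> card A"
    using c assms(3) by (intro card_inj_on_le) auto
  then show False using assms(2) by simp
qed

text \<open>One \<open>f\<close> must serve for all domains at once. The values of \<open>u\<close>
  are split at a wide gap: the part below is unranked by induction on a bound for the domain, and
  the part above exceeds the bound from \<open>unranked_bound\<close> for the stem so
  obtained.\<close>

lemma unranked_cone:
  assumes "\<nexists>T. ranked W T p"
  shows "\<exists>f. \<forall>u. finite (dom u) \<longrightarrow> dom u \<inter> dom p = {} \<longrightarrow> (\<forall>n v. u n = Some v \<longrightarrow> f n \<le> v) \<longrightarrow>
    (\<nexists>T. ranked W T (p ++ u))"
proof -
  let ?R = "\<lambda>q. \<exists>T. ranked W T q"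
  have "\<forall>v E. \<exists>F. \<not> ?R (p ++ v) \<longrightarrow> finite E \<longrightarrow> E \<inter> dom (p ++ v) = {} \<longrightarrow>
    (\<forall>u. dom u = E \<longrightarrow> (\<forall>n w. u n = Some w \<longrightarrow> F \<le> w) \<longrightarrow> \<not> ?R (p ++ v ++ u))"
  proof (intro allI)
    fix v E
    show "\<exists>F. \<not> ?R (p ++ v) \<longrightarrow> finite E \<longrightarrow> E \<inter> dom (p ++ v) = {} \<longrightarrow>
      (\<forall>u. dom u = E \<longrightarrow> (\<forall>n w. u n = Some w \<longrightarrow> F \<le> w) \<longrightarrow> \<not> ?R (p ++ v ++ u))"
      using unranked_bound[of W "p ++ v" E] by (cases "?R (p ++ v)") (simp, metis)
  qed
  then obtain F where F: "\<And>v E u. \<lbrakk>\<not> ?R (p ++ v); finite E; E \<inter> dom (p ++ v) = {}; dom u = E;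
      \<And>n w. u n = Some w \<Longrightarrow> F v E \<le> w\<rbrakk> \<Longrightarrow> \<not> ?R (p ++ v ++ u)"
    by metis
  \<comment> \<open>Only finitely many lower parts have domain below \<open>m\<close> and values
    below \<open>b\<close>, so one number exceeds all their bounds.\<close>
  define X where "X m b = (\<lambda>(v, E). F v E) ` ({v. dom v \<subseteq> {..<m} \<and> ran v \<subseteq> {..<b}} \<times> Pow {..<m})"
    for m b :: nat
  have finX: "finite (X m b)" for m b
    unfolding X_def by (intro finite_imageI finite_cartesian_product finite_bounded_maps) simp
  define B where "B m b = Max (insert b (X m b))" for m b
  have Bge: "b \<le> B m b" for m b
    using finX by (simp add: B_def)
  have BF: "F v E \<le> B m b" if "dom v \<subseteq> {..<m}" "ran v \<subseteq> {..<b}" "E \<subseteq> {..<m}" for v E m b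
    unfolding B_def using that finX by (intro Max_ge) (auto simp: X_def)
  \<comment> \<open>\<open>Suc m\<close> iterations leave \<open>m + 1\<close> successive intervals
    below \<open>f m\<close>, one more than there are coordinates before \<open>m\<close>.\<close>
  define f where "f m = (B (Suc m) ^^ Suc m) 0" for m
  have main: "\<not> ?R (p ++ u)" if "dom u \<subseteq> {..<m}" "dom u \<inter> dom p = {}"
    "\<And>n v. u n = Some v \<Longrightarrow> f n \<le> v" for u m
    using that
  proof (induction m arbitrary: u)
    case 0
    then show ?case using assms by simp
  next
    case (Suc m)
    show ?case
    proof (cases "m \<in> dom u")
      case False
      then have "dom u \<subseteq> {..<m}" using Suc.prems(1) by (auto simp: lessThan_Suc)
      then show ?thesis using Suc.IH Suc.prems(2,3) by blast
    next
      case True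
      define b where "b i = (B (Suc m) ^^ i) 0" for i
      have b_mono: "mono b"
        by (rule incseq_SucI) (simp add: b_def Bge)
      have "card (dom u - {m}) \<le> m"
      proof -
        have "dom u - {m} \<subseteq> {..<m}" using Suc.prems(1) by (auto simp: lessThan_Suc)
        then show ?thesis using card_mono[of "{..<m}" "dom u - {m}"] by simp
      qed
      moreover have "finite (dom u - {m})"
        using Suc.prems(1) finite_subset[OF _ finite_lessThan[of "Suc m"]] by blast
      ultimately obtain i where "i \<le> m"
        and i: "\<And>n. n \<in> dom u - {m} \<Longrightarrow> the (u n) < b i \<or> b (Suc i) \<le> the (u n)"
        using ex_empty_gap[OF b_mono, of "dom u - {m}" m "\<lambda>n. the (u n)"] by blast
      \<comment> \<open>The value at \<open>m\<close> lies above every candidate gap, so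
        \<open>m\<close> falls into the upper part and the induction hypothesis applies to the lower
        one.\<close>
      have um: "b (Suc i) \<le> the (u m)"
      proof -
        have "b (Suc i) \<le> b (Suc m)" using b_mono \<open>i \<le> m\<close> by (simp add: mono_def)
        also have "\<dots> = f m" by (simp add: b_def f_def)
        also have "\<dots> \<le> the (u m)" using True Suc.prems(3) by force
        finally show ?thesis .
      qed
      have gap: "the (u n) < b i \<or> b (Suc i) \<le> the (u n)" if "n \<in> dom u" for n
        using i[of n] um that by (cases "n = m") auto
      define G where "G = {n. the (u n) < b i}"
      have bi: "b i \<le> b (Suc i)" using b_mono by (simp add: mono_def)
      have mG: "m \<notin> G" using um bi by (auto simp: G_def)
      have domv: "dom (u |` G) \<subseteq> {..<m}"
        using Suc.prems(1) mG unfolding lessThan_Suc dom_restrict by blast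
      have *: "\<not> ?R (p ++ (u |` G))"
      proof (rule Suc.IH[OF domv])
        show "dom (u |` G) \<inter> dom p = {}" using Suc.prems(2) by auto
        show "f n \<le> v" if "(u |` G) n = Some v" for n v
          using that Suc.prems(3) by (auto simp: restrict_map_def split: if_splits)
      qed
      have "\<not> ?R (p ++ (u |` G) ++ (u |` (- G)))"
      proof (rule F[OF *])
        show "finite (dom u - G)" using Suc.prems(1) finite_subset[OF _ finite_lessThan[of "Suc m"]] by blast
        show "(dom u - G) \<inter> dom (p ++ (u |` G)) = {}"
          using Suc.prems(2) by auto
        show "dom (u |` (- G)) = dom u - G" by auto
        fix n w assume nw: "(u |` (- G)) n = Some w"
        then have "u n = Some w" "n \<notin> G" by (auto simp: restrict_map_def split: if_splits)
        then have "b (Suc i) \<le> w" using gap[of n] by (auto simp: G_def)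
        moreover have "F (u |` G) (dom u - G) \<le> b (Suc i)"
        proof -
          have "ran (u |` G) \<subseteq> {..<b i}"
            by (auto simp: ran_def restrict_map_def G_def split: if_splits)
          moreover have "dom (u |` G) \<subseteq> {..<Suc m}" using domv by (simp add: lessThan_Suc subset_insertI2)
          moreover have "dom u - G \<subseteq> {..<Suc m}" using Suc.prems(1) by blast
          ultimately show ?thesis using BF[of "u |` G" "Suc m" "b i"] by (simp add: b_def)
        qed
        ultimately show "F (u |` G) (dom u - G) \<le> w" by linarith
      qed
      moreover have "p ++ (u |` G) ++ (u |` (- G)) = p ++ u"
        by (rule ext) (auto simp: map_add_def restrict_map_def split: option.splits)
      ultimately show ?thesis by simp
    qed
  qed
  show ?thesis
  proof (intro exI allI impI)
    fix u assume "finite (dom u)" "dom u \<inter> dom p = {}" "\<forall>n v. u n = Some v \<longrightarrow> f n \<le> v"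
    moreover obtain m where "dom u \<subseteq> {..<m}"
      using finite_nat_bounded[OF \<open>finite (dom u)\<close>] by auto
    ultimately show "\<not> ?R (p ++ u)" using main by blast
  qed
qed

text \<open>An unranked \<open>p\<close> has a whole cone of unranked extensions, but density puts
  into it a stem satisfying \<open>W\<close>, which has rank \<open>Leaf\<close>.\<close>

lemma dense_ranked:
  assumes dense: "\<And>f. \<exists>q. finite (dom q) \<and> extends_above f p q \<and> W q"
  shows "\<exists>T. ranked W T p"
proof (rule ccontr)
  assume "\<not> ?thesis"
  then obtain f where f: "\<And>u. \<lbrakk>finite (dom u); dom u \<inter> dom p = {};
      \<And>n v. u n = Some v \<Longrightarrow> f n \<le> v\<rbrakk> \<Longrightarrow> \<nexists>T. ranked W T (p ++ u)"
    using unranked_cone[of W p] by metis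
  obtain q where q: "finite (dom q)" "extends_above f p q" "W q"
    using dense by blast
  have "p ++ (q |` (- dom p)) = q"
  proof
    fix n show "(p ++ (q |` (- dom p))) n = q n"
      using q(2) by (cases "n \<in> dom p")
        (auto simp: map_add_def restrict_map_def extends_above_def map_le_def split: option.splits)
  qed
  moreover have "\<nexists>T. ranked W T (p ++ (q |` (- dom p)))"
  proof (rule f)
    show "finite (dom (q |` (- dom p)))" using q(1) by simp
    show "f n \<le> v" if "(q |` (- dom p)) n = Some v" for n v
      using that q(2) by (auto simp: restrict_map_def extends_above_def split: if_splits)
  qed auto
  ultimately show False using ranked.leaf[of W q] q(3) by metis
qed

section \<open>Coding branches of a Laver tree\<close>

definition succs :: "nat list set \<Rightarrow> nat list \<Rightarrow> nat set" where
  "succs L t = {m. t @ [m] \<in> L}"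

definition child :: "nat list set \<Rightarrow> nat list \<Rightarrow> nat \<Rightarrow> nat list" where
  "child L t v = t @ [enumerate (succs L t) v]"

text \<open>A point \<open>x\<close> acts as a strategy: at the node \<open>t\<close> it picks the successor with
  index \<open>x (to_nat t)\<close>. Distinct nodes read distinct coordinates, so for generic \<open>x\<close> in
  the dominating topology the resulting branch eventually exceeds every bound that depends on the
  node, which a branch reading \<open>x\<close> in order would not.\<close>

primrec walk :: "nat list set \<Rightarrow> nat list \<Rightarrow> (nat \<Rightarrow> nat) \<Rightarrow> nat \<Rightarrow> nat list" where
  "walk L s x 0 = s"
| "walk L s x (Suc n) = child L (walk L s x n) (x (to_nat (walk L s x n)))"

text \<open>Even for empty \<open>s\<close>, the node after \<open>Suc i\<close> steps has an entry
  at \<open>i\<close>.\<close>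

definition coded_branch :: "nat list set \<Rightarrow> nat list \<Rightarrow> (nat \<Rightarrow> nat) \<Rightarrow> nat \<Rightarrow> nat" where
  "coded_branch L s x i = walk L s x (Suc i) ! i"

lemma length_walk [simp]: "length (walk L s x n) = length s + n"
  by (induction n) (auto simp: child_def)

lemma prefix_walk: "prefix (walk L s x n) (walk L s x (k + n))"
  by (induction k) (auto simp: child_def intro: prefix_order.trans)

lemma walk_cong:
  assumes "\<And>l. l < n \<Longrightarrow> x (to_nat (walk L s x l)) = z (to_nat (walk L s x l))"
  shows "walk L s z n = walk L s x n"
  using assms by (induction n) auto

text \<open>Earlier nodes are prefixes of later ones, so the walk need be known only from step
  \<open>k\<close> on.\<close>

lemma coded_branch_eqI:
  assumes "\<And>n. walk L s x (k + n) = map y [0..<length s + k + n]"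
  shows "coded_branch L s x = y"
proof
  fix i
  have "prefix (walk L s x (Suc i)) (map y [0..<length s + k + Suc i])"
    using prefix_walk[of L s x "Suc i" k] unfolding assms .
  then obtain zs where zs: "map y [0..<length s + k + Suc i] = walk L s x (Suc i) @ zs"
    by (auto simp only: prefix_def)
  have "walk L s x (Suc i) ! i = (walk L s x (Suc i) @ zs) ! i"
    by (simp add: nth_append del: walk.simps)
  also have "\<dots> = y i"
    unfolding zs[symmetric] by (simp del: upt_Suc)
  finally show "coded_branch L s x i = y i"
    by (simp only: coded_branch_def)
qed

lemma continuous_on_locally_determined:
  fixes h :: "('a \<Rightarrow> nat) \<Rightarrow> 'b \<Rightarrow> nat"
  assumes "\<And>x i. \<exists>K. finite K \<and> (\<forall>z. (\<forall>k\<in>K. x k = z k) \<longrightarrow> h z i = h x i)"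
  shows "continuous_on UNIV h"
proof (rule continuous_on_coordinatewise_then_product)
  fix i
  have "open ((\<lambda>x. h x i) -` B)" for B
  proof (rule open_subopen[THEN iffD2], rule ballI)
    fix x assume x: "x \<in> (\<lambda>x. h x i) -` B"
    obtain K where K: "finite K" "\<And>z. (\<forall>k\<in>K. x k = z k) \<Longrightarrow> h z i = h x i"
      using assms by blast
    let ?V = "\<Inter>k\<in>K. (\<lambda>z. z k) -` {x k}"
    have "open ?V"
      by (intro open_INT ballI open_vimage K(1) continuous_on_product_coordinates open_discrete)
    moreover have "?V \<subseteq> (\<lambda>x. h x i) -` B"
    proof
      fix z assume "z \<in> ?V"
      then have "h z i = h x i" by (intro K(2)) simp
      then show "z \<in> (\<lambda>x. h x i) -` B" using x by simp
    qed
    moreover have "x \<in> ?V" by simp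
    ultimately show "\<exists>T. open T \<and> x \<in> T \<and> T \<subseteq> (\<lambda>x. h x i) -` B" by blast
  qed
  then show "continuous_on UNIV (\<lambda>x. h x i)"
    by (simp add: continuous_on_open_vimage)
qed

lemma continuous_on_coded_branch: "continuous_on UNIV (coded_branch L s)"
proof (rule continuous_on_locally_determined)
  fix x i
  let ?K = "(\<lambda>l. to_nat (walk L s x l)) ` {..<Suc i}"
  have "coded_branch L s z i = coded_branch L s x i" if "\<forall>k\<in>?K. x k = z k" for z
    unfolding coded_branch_def using that walk_cong[of "Suc i" x L s z]
    by (metis image_eqI lessThan_iff)
  then show "\<exists>K. finite K \<and> (\<forall>z. (\<forall>k\<in>K. x k = z k) \<longrightarrow> coded_branch L s z i = coded_branch L s x i)"
    by (intro exI[of _ ?K]) blast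
qed

section \<open>Successors and their codes\<close>

lemma succs_infinite:
  assumes "laver_tree_stem L s" "t \<in> L" "prefix s t"
  shows "infinite (succs L t)"
  using assms unfolding laver_tree_stem_def succs_def by blast

lemma child_in_tree:
  assumes "laver_tree_stem L s" "t \<in> L" "prefix s t"
  shows "child L t v \<in> L" "prefix s (child L t v)"
  using enumerate_in_set[OF succs_infinite[OF assms], of v] assms(3)
  by (auto simp: child_def succs_def)

lemma walk_in_tree:
  assumes "laver_tree_stem L s"
  shows "walk L s x n \<in> L \<and> prefix s (walk L s x n)"
proof (induction n)
  case 0
  then show ?case using assms by (simp add: laver_tree_stem_def)
next
  case (Suc n)
  then show ?case using child_in_tree[OF assms] by simp
qed

lemma inj_enumerate_succs:
  assumes "laver_tree_stem L s" "t \<in> L" "prefix s t"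
  shows "inj (enumerate (succs L t))"
  using strict_mono_enumerate[OF succs_infinite[OF assms]] strict_mono_imp_inj_on by blast

text \<open>Distinct successors have distinct codes; thus keeping the coordinate of the next node
  free excludes only finitely many successors.\<close>

lemma finite_child_codes:
  assumes "laver_tree_stem L s" "t \<in> L" "prefix s t" "finite D"
  shows "finite {v. to_nat (child L t v) \<in> D}"
proof -
  have "inj (\<lambda>v. to_nat (child L t v))"
    using inj_enumerate_succs[OF assms(1-3)] by (auto simp: inj_def child_def)
  then show ?thesis using finite_vimageI[OF assms(4)] by (simp add: vimage_def)
qed

section \<open>Fusion\<close>

text \<open>Fixing a next state for each possible next entry yields a tree with stem
  \<open>tip a\<close>; it is a Laver tree because every state has infinitely many entries to offer,
  and a branch recovers the states along it.\<close>

lemma laver_fusion: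
  fixes tip :: "'a \<Rightarrow> nat list"
  assumes tree: "is_tree L" and "Inv a" and tip_in: "\<And>b. Inv b \<Longrightarrow> tip b \<in> L"
    and step: "\<And>b. Inv b \<Longrightarrow> infinite {m. \<exists>c. Inv c \<and> step b c \<and> tip c = tip b @ [m]}"
  obtains L' where "laver_tree L'" "L' \<subseteq> L"
    "\<And>y. y \<in> branches L' \<Longrightarrow> \<exists>\<alpha>. \<alpha> 0 = a \<and>
      (\<forall>n. Inv (\<alpha> n) \<and> step (\<alpha> n) (\<alpha> (Suc n)) \<and> tip (\<alpha> n) = map y [0..<length (tip a) + n])"
proof -
  define M where "M b = {m. \<exists>c. Inv c \<and> step b c \<and> tip c = tip b @ [m]}" for b
  \<comment> \<open>One choice per entry makes the state a function of the node, so the states along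
    a branch cohere.\<close>
  define nxt where "nxt b m = (SOME c. Inv c \<and> step b c \<and> tip c = tip b @ [m])" for b m
  have nxt: "Inv (nxt b m) \<and> step b (nxt b m) \<and> tip (nxt b m) = tip b @ [m]" if "m \<in> M b" for b m
    unfolding nxt_def by (rule someI_ex) (use that in \<open>simp add: M_def\<close>)
  define st where "st t = foldl nxt a t" for t
  have st_simps [simp]: "st [] = a" "st (t @ [m]) = nxt (st t) m" for t m
    by (auto simp: st_def)
  define K where "K = {t. \<forall>i<length t. t ! i \<in> M (st (take i t))}"
  have K_snoc: "t @ [m] \<in> K \<longleftrightarrow> t \<in> K \<and> m \<in> M (st t)" for t m
    unfolding K_def by (auto simp: less_Suc_eq nth_append)
  have K_nil: "[] \<in> K" by (simp add: K_def)
  have K_prefix: "t' \<in> K" if "t \<in> K" and pre: "prefix t' t" for t t'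
  proof -
    obtain r where "t = t' @ r" using pre by (auto simp: prefix_def)
    have "t' ! i \<in> M (st (take i t'))" if i: "i < length t'" for i
    proof -
      have "i < length t" using i \<open>t = t' @ r\<close> by simp
      then have "t ! i \<in> M (st (take i t))" using \<open>t \<in> K\<close> unfolding K_def by blast
      moreover have "t ! i = t' ! i" "take i t = take i t'"
        using i \<open>t = t' @ r\<close> by (simp_all add: nth_append)
      ultimately show ?thesis by simp
    qed
    then show ?thesis by (simp add: K_def)
  qed
  have K_inv: "Inv (st t) \<and> tip (st t) = tip a @ t" if "t \<in> K" for t
    using that
  proof (induction t rule: rev_induct)
    case Nil
    then show ?case using \<open>Inv a\<close> by simp
  next
    case (snoc m t)
    then have "m \<in> M (st t)" "Inv (st t)" "tip (st t) = tip a @ t" by (auto simp: K_snoc)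
    then show ?case using nxt[of m "st t"] by simp
  qed
  define L' where "L' = {r. prefix r (tip a)} \<union> (\<lambda>t. tip a @ t) ` K"
  have tip_L': "tip a @ t \<in> L' \<longleftrightarrow> t \<in> K" for t
    using K_nil by (auto simp: L'_def prefix_def)
  have "is_tree L'"
    unfolding is_tree_def
  proof (intro conjI ballI allI impI)
    show "L' \<noteq> {}" by (auto simp: L'_def)
    fix t r assume "t \<in> L'" "prefix r t"
    then show "r \<in> L'"
      using K_prefix unfolding L'_def by (auto simp: prefix_append dest: prefix_order.trans)
  qed
  moreover have "infinite {n. t @ [n] \<in> L'}" if t: "t \<in> L'" "prefix (tip a) t" for t
  proof -
    obtain r where r: "t = tip a @ r" using t(2) by (auto simp: prefix_def)
    then have "r \<in> K" using t(1) tip_L' by simp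
    moreover have "{n. t @ [n] \<in> L'} = {n. r @ [n] \<in> K}"
      using tip_L' r by simp
    ultimately have "{n. t @ [n] \<in> L'} = M (st r)" by (simp add: K_snoc)
    moreover have "infinite (M (st r))" using step K_inv \<open>r \<in> K\<close> unfolding M_def by blast
    ultimately show ?thesis by simp
  qed
  moreover have "tip a \<in> L'" "\<forall>t\<in>L'. prefix t (tip a) \<or> prefix (tip a) t"
    by (auto simp: L'_def)
  ultimately have "laver_tree L'" unfolding laver_tree_def laver_tree_stem_def by blast
  moreover have "L' \<subseteq> L"
  proof
    fix r assume "r \<in> L'"
    then consider "prefix r (tip a)" | t where "t \<in> K" "r = tip a @ t" by (auto simp: L'_def)
    then show "r \<in> L"
    proof cases
      case 1
      then show ?thesis using tree tip_in[OF \<open>Inv a\<close>] by (auto simp: is_tree_def)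
    next
      case 2
      then show ?thesis using K_inv tip_in by metis
    qed
  qed
  moreover have "\<exists>\<alpha>. \<alpha> 0 = a \<and> (\<forall>n. Inv (\<alpha> n) \<and> step (\<alpha> n) (\<alpha> (Suc n)) \<and>
      tip (\<alpha> n) = map y [0..<length (tip a) + n])" if y: "y \<in> branches L'" for y
  proof -
    let ?l = "length (tip a)"
    define t where "t n = map y [?l..<?l + n]" for n
    have yL: "map y [0..<n] \<in> L'" for n using y by (simp add: branches_def)
    have "map y [0..<?l] = tip a"
    proof -
      consider "prefix (map y [0..<?l]) (tip a)" | r where "map y [0..<?l] = tip a @ r"
        using yL[of ?l] by (auto simp: L'_def)
      then show ?thesis
      proof cases
        case 1
        then show ?thesis by (simp add: prefix_def) (metis append_eq_append_conv append_self_conv length_map length_upt minus_nat.diff_0)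
      next
        case 2
        from arg_cong[OF this, of length] have "r = []" by simp
        with 2 show ?thesis by simp
      qed
    qed
    then have split: "map y [0..<?l + n] = tip a @ t n" for n
      using upt_add_eq_append[of 0 ?l n] by (simp add: t_def)
    have tK: "t n \<in> K" for n using yL[of "?l + n"] by (simp only: split tip_L')
    have tS: "t (Suc n) = t n @ [y (?l + n)]" for n by (simp add: t_def)
    have "step (st (t n)) (st (t (Suc n)))" for n
      using tK[of "Suc n"] nxt by (simp add: tS K_snoc)
    moreover have "st (t 0) = a" by (simp add: t_def)
    ultimately show ?thesis
      using K_inv tK split by (intro exI[of _ "\<lambda>n. st (t n)"]) simp
  qed
  ultimately show thesis using that by blast
qed

section \<open>Laver trees of coded generic points\<close>

text \<open>Covering \<open>{..<j}\<close> makes the stems along a branch exhaust all coordinates,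
  so that together they define a point.\<close>

definition meets :: "(nat \<Rightarrow> (nat \<Rightarrow> nat) set) \<Rightarrow> nat \<Rightarrow> (nat \<rightharpoonup> nat) \<Rightarrow> bool" where
  "meets S j p \<longleftrightarrow> {..<j} \<subseteq> dom p \<and> (\<exists>g. cyl p g \<inter> S j = {})"

lemma ranked_meets:
  assumes "nowhere_dense_in dominating_topology (S j)" "finite (dom p)"
  shows "\<exists>T. ranked (meets S j) T p"
proof (rule dense_ranked)
  fix f
  show "\<exists>q. finite (dom q) \<and> extends_above f p q \<and> meets S j q"
    using nowhere_dense_avoid[OF assms, of f j] unfolding meets_def by auto
qed

text \<open>A state \<open>(p, f, j, T, t)\<close>: the stem built so far, the lower bound promised for all
  remaining coordinates, the index of the nowhere dense set to be avoided next, a rank for that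
  task, and the tree node reached by \<open>p\<close>, whose coordinate is still free.\<close>

type_synonym state = "(nat \<rightharpoonup> nat) \<times> (nat \<Rightarrow> nat) \<times> nat \<times> rank_tree \<times> nat list"

fun valid_state ::
  "(nat \<Rightarrow> (nat \<Rightarrow> nat) set) \<Rightarrow> nat list set \<Rightarrow> nat list \<Rightarrow> state \<Rightarrow> bool" where
  "valid_state S L s (p, f, j, T, t) \<longleftrightarrow>
     finite (dom p) \<and> ranked (meets S j) T p \<and> to_nat t \<notin> dom p \<and> t \<in> L \<and> prefix s t"

text \<open>A step lowers the rank or else finishes with \<open>S j\<close>. The transitive closure
  is needed as a step may pass several levels of the rank before the coordinate of \<open>t\<close>
  is set.\<close>

fun next_state :: "(nat \<Rightarrow> (nat \<Rightarrow> nat) set) \<Rightarrow> nat list set \<Rightarrow> state \<Rightarrow> state \<Rightarrow> bool" where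
  "next_state S L (p, f, j, T, t) (p', f', j', T', t') \<longleftrightarrow>
     extends_above f p p' \<and> f \<le> f' \<and> (\<exists>v. p' (to_nat t) = Some v \<and> t' = child L t v) \<and>
     (j' = j \<and> (T', T) \<in> immediate_subtree\<^sup>+ \<or>
      j' = Suc j \<and> {..<j} \<subseteq> dom p' \<and> cyl p' f' \<inter> S j = {})"

lemma extends_above_map_add:
  assumes "\<And>n v. u n = Some v \<Longrightarrow> f n \<le> v" "dom u \<inter> dom p = {}"
  shows "extends_above f p (p ++ u)"
proof -
  have "p \<subseteq>\<^sub>m p ++ u" using assms(2) by (metis map_add_comm map_le_map_add inf_commute)
  then show ?thesis using assms(1) by (auto simp: extends_above_def map_add_Some_iff)
qed

text \<open>Induction on the rank. A leaf allows every large value at the coordinate of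
  \<open>t\<close>. At a node with this coordinate in \<open>E\<close> the offered values tend to
  infinity; otherwise one extension is committed to and the argument continues below it. Used codes
  exclude finitely many values.\<close>

lemma infinite_next_states:
  assumes L: "laver_tree_stem L s" and S: "\<And>j::nat. nowhere_dense_in dominating_topology (S j)"
    and "ranked (meets S j) T p" "finite (dom p)" "to_nat t \<notin> dom p" "t \<in> L" "prefix s t"
  shows "infinite {v. \<exists>p' f' j' T'. valid_state S L s (p', f', j', T', child L t v) \<and>
    next_state S L (p, f, j, T, t) (p', f', j', T', child L t v)}"
  using assms(3-5)
proof (induction rule: ranked.induct)
  case (leaf p)
  obtain g where g: "cyl p g \<inter> S j = {}" "{..<j} \<subseteq> dom p" using leaf.hyps by (auto simp: meets_def)
  \<comment> \<open>The maximum keeps the promise \<open>f\<close> and adds \<open>g\<close>, under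
    which \<open>S j\<close> is avoided.\<close>
  let ?c = "to_nat t" and ?h = "\<lambda>n. max (f n) (g n)"
  let ?bad = "{v. to_nat (child L t v) \<in> insert ?c (dom p)}"
  have "{max (f ?c) (g ?c)..} - ?bad \<subseteq> {v. \<exists>p' f' j' T'. valid_state S L s (p', f', j', T', child L t v) \<and>
    next_state S L (p, f, j, Leaf, t) (p', f', j', T', child L t v)}"
  proof
    fix v assume v: "v \<in> {max (f ?c) (g ?c)..} - ?bad"
    let ?p = "p(?c \<mapsto> v)"
    obtain T' where T': "ranked (meets S (Suc j)) T' ?p"
      using ranked_meets[where S = S and j = "Suc j" and p = ?p, OF S] leaf.prems(1) by auto
    have "valid_state S L s (?p, ?h, Suc j, T', child L t v)"
      using T' v leaf.prems child_in_tree[OF L assms(6,7)] by auto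
    moreover have "extends_above k p ?p" if "k ?c \<le> v" for k
      using that leaf.prems(2) by (auto simp: extends_above_def map_le_def)
    then have "extends_above f p ?p" "extends_above g p ?p" using v by auto
    moreover from this(2) have "cyl ?p ?h \<subseteq> cyl p g"
      by (rule cyl_antimono) (simp add: le_fun_def)
    then have "cyl ?p ?h \<inter> S j = {}" using g(1) by blast
    ultimately have "valid_state S L s (?p, ?h, Suc j, T', child L t v) \<and>
        next_state S L (p, f, j, Leaf, t) (?p, ?h, Suc j, T', child L t v)"
      using g(2) by (auto simp: le_fun_def)
    then show "v \<in> {v. \<exists>p' f' j' T'. valid_state S L s (p', f', j', T', child L t v) \<and>
      next_state S L (p, f, j, Leaf, t) (p', f', j', T', child L t v)}" by blast
  qed
  moreover have "finite ?bad"
    using leaf.prems(1) by (intro finite_child_codes[OF L assms(6,7)]) simp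
  then have "infinite ({max (f ?c) (g ?c)..} - ?bad)"
    by (simp add: Diff_infinite_finite infinite_Ici)
  ultimately show ?case using finite_subset by blast
next
  case (node E p u T)
  let ?c = "to_nat t"
  have fin: "finite (dom (p ++ u k))" for k using node by simp
  \<comment> \<open>From index \<open>b\<close> on, the values of \<open>u k\<close> respect the
    promise \<open>f\<close> on \<open>E\<close>.\<close>
  define b where "b = Max (insert 0 (f ` E))"
  have ext: "extends_above f p (p ++ u k)" if "b \<le> k" for k
  proof (rule extends_above_map_add)
    show "dom (u k) \<inter> dom p = {}" using node by simp
    fix n v assume nv: "u k n = Some v"
    then have "n \<in> E" using node.hyps(3)[of k] by blast
    then have "f n \<le> b" using node.hyps(1) by (simp add: b_def)
    then show "f n \<le> v" using node.hyps(4)[OF nv] that by linarith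
  qed
  have sub: "(T k, Node T) \<in> immediate_subtree" for k by (auto simp: immediate_subtree_def)
  show ?case
  proof (cases "?c \<in> E")
    case False
    then have "?c \<notin> dom (p ++ u b)" using node by simp
    \<comment> \<open>A step possible after the extension \<open>u b\<close> is a step from
      \<open>p\<close> as well: its new values respect \<open>f\<close>, and a rank below
      \<open>T b\<close> is below \<open>Node T\<close>.\<close>
    from node.IH[OF fin this] show ?thesis
    proof (rule contrapos_nn)
      assume fin: "finite {v. \<exists>p' f' j' T'. valid_state S L s (p', f', j', T', child L t v) \<and>
        next_state S L (p, f, j, Node T, t) (p', f', j', T', child L t v)}"
      show "finite {v. \<exists>p' f' j' T'. valid_state S L s (p', f', j', T', child L t v) \<and>
        next_state S L (p ++ u b, f, j, T b, t) (p', f', j', T', child L t v)}"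
      proof (rule finite_subset[OF _ fin], safe)
        fix v p' f' j' T'
        assume "valid_state S L s (p', f', j', T', child L t v)"
          and "next_state S L (p ++ u b, f, j, T b, t) (p', f', j', T', child L t v)"
        moreover from this(2) have "next_state S L (p, f, j, Node T, t) (p', f', j', T', child L t v)"
          using extends_above_trans[OF ext[of b]] sub[of b]
          by (auto intro: trancl_into_trancl)
        ultimately show "\<exists>p' f' j' T'. valid_state S L s (p', f', j', T', child L t v) \<and>
          next_state S L (p, f, j, Node T, t) (p', f', j', T', child L t v)" by blast
      qed
    qed
  next
    case True
    define w where "w k = the (u k ?c)" for k
    have w: "u k ?c = Some (w k)" for k
      using True node.hyps(3)[of k] by (auto simp: w_def dom_def)
    have wk: "k \<le> w k" for k using node.hyps(4)[OF w] .
    let ?bad = "{v. to_nat (child L t v) \<in> dom p \<union> E}"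
    \<comment> \<open>Different \<open>k\<close> may give equal values, so it is the set of values
      that must be infinite; it is unbounded by \<open>k \<le> w k\<close>.\<close>
    have "infinite (w ` {b..})"
      unfolding infinite_nat_iff_unbounded_le
    proof
      fix m
      have "m \<le> w (max m b)" using wk[of "max m b"] by linarith
      then show "\<exists>n\<ge>m. n \<in> w ` {b..}" by (intro exI[of _ "w (max m b)"]) auto
    qed
    moreover have "finite ?bad"
      using node.prems(1) node.hyps(1) by (intro finite_child_codes[OF L assms(6,7)]) simp
    ultimately have "infinite (w ` {b..} - ?bad)" by (simp add: Diff_infinite_finite)
    moreover have "w ` {b..} - ?bad \<subseteq> {v. \<exists>p' f' j' T'. valid_state S L s (p', f', j', T', child L t v) \<and>
      next_state S L (p, f, j, Node T, t) (p', f', j', T', child L t v)}"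
    proof
      fix v assume "v \<in> w ` {b..} - ?bad"
      then obtain k where k: "b \<le> k" "v = w k" "to_nat (child L t v) \<notin> dom p \<union> E" by auto
      have "valid_state S L s (p ++ u k, f, j, T k, child L t v)"
        using node.hyps(3,5)[of k] fin[of k] k(3) child_in_tree[OF L assms(6,7)] by auto
      moreover have "next_state S L (p, f, j, Node T, t) (p ++ u k, f, j, T k, child L t v)"
        using ext[OF k(1)] w[of k] k(2) sub[of k] by auto
      ultimately show "v \<in> {v. \<exists>p' f' j' T'. valid_state S L s (p', f', j', T', child L t v) \<and>
        next_state S L (p, f, j, Node T, t) (p', f', j', T', child L t v)}" by blast
    qed
    ultimately show ?thesis using finite_subset by blast
  qed
qed

lemma infinite_next_tips:
  assumes L: "laver_tree_stem L s" and S: "\<And>j::nat. nowhere_dense_in dominating_topology (S j)"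
    and "valid_state S L s (p, f, j, T, t)"
  shows "infinite {m. \<exists>p' f' j' T'. valid_state S L s (p', f', j', T', t @ [m]) \<and>
    next_state S L (p, f, j, T, t) (p', f', j', T', t @ [m])}" (is "infinite ?M")
proof -
  have t: "ranked (meets S j) T p" "finite (dom p)" "to_nat t \<notin> dom p" "t \<in> L" "prefix s t"
    using assms(3) by auto
  let ?V = "{v. \<exists>p' f' j' T'. valid_state S L s (p', f', j', T', child L t v) \<and>
    next_state S L (p, f, j, T, t) (p', f', j', T', child L t v)}"
  have "infinite (enumerate (succs L t) ` ?V)"
    using infinite_next_states[OF L S t] inj_enumerate_succs[OF L t(4,5)]
    by (meson finite_imageD inj_on_subset subset_UNIV)
  moreover have "enumerate (succs L t) ` ?V \<subseteq> ?M"
    unfolding child_def by (rule image_subsetI) (simp only: mem_Collect_eq)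
  ultimately show ?thesis by (rule infinite_super[rotated])
qed

text \<open>Along a branch the rank cannot drop forever, so each \<open>S j\<close> is avoided at
  some stage; the union of the stems is then a point coding the branch.\<close>

lemma laver_tree_of_coded_generics:
  assumes L: "laver_tree_stem L s" and S: "\<And>j::nat. nowhere_dense_in dominating_topology (S j)"
  obtains L' where "laver_tree L'" "L' \<subseteq> L"
    "branches L' \<subseteq> coded_branch L s ` (dom_basic N f - (\<Union>j. S j))"
proof -
  \<comment> \<open>All points of \<open>dom_basic N f\<close> share the walk up to the first node
    with code at least \<open>N\<close>, which becomes the stem of the new tree. It exists as
    distinct nodes have distinct codes.\<close>
  define P where "P k \<longleftrightarrow> N \<le> to_nat (walk L s f k)" for k
  have "inj (\<lambda>k. to_nat (walk L s f k))"
    by (rule injI) (metis add_left_cancel length_walk from_nat_to_nat)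
  then have "finite ((\<lambda>k. to_nat (walk L s f k)) -` {..<N})" by (intro finite_vimageI) auto
  then obtain k0 where "k0 \<notin> (\<lambda>k. to_nat (walk L s f k)) -` {..<N}"
    using ex_new_if_finite infinite_UNIV_nat by blast
  then have "P k0" by (simp add: P_def)
  define k where "k = (LEAST k. P k)"
  have "P k" unfolding k_def using \<open>P k0\<close> by (rule LeastI)
  have below: "to_nat (walk L s f l) < N" if "l < k" for l
    using not_less_Least[of l P] that by (simp add: k_def P_def)
  obtain T0 where T0: "ranked (meets S 0) T0 (initial_map f N)"
    using ranked_meets[where S = S and j = 0 and p = "initial_map f N", OF S] by auto
  define a where "a = (initial_map f N, f, 0 :: nat, T0, walk L s f k)"
  define tip :: "state \<Rightarrow> nat list" where "tip b = snd (snd (snd (snd b)))" for b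
  have a: "valid_state S L s a"
    using T0 \<open>P k\<close> walk_in_tree[OF L] by (simp add: a_def P_def)
  have tree: "is_tree L" using L by (simp add: laver_tree_stem_def)
  have tip_in: "tip b \<in> L" if "valid_state S L s b" for b
    using that by (cases b) (auto simp: tip_def)
  have step: "infinite {m. \<exists>c. valid_state S L s c \<and> next_state S L b c \<and> tip c = tip b @ [m]}"
    if "valid_state S L s b" for b
  proof -
    obtain p g j T t where b: "b = (p, g, j, T, t)" by (cases b) auto
    show ?thesis
    proof (rule infinite_super[OF _ infinite_next_tips[OF L S that[unfolded b]]], rule subsetI)
      fix m assume "m \<in> {m. \<exists>p' f' j' T'. valid_state S L s (p', f', j', T', t @ [m]) \<and>
        next_state S L (p, g, j, T, t) (p', f', j', T', t @ [m])}"
      then obtain p' f' j' T' where "valid_state S L s (p', f', j', T', t @ [m])"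
        "next_state S L b (p', f', j', T', t @ [m])"
        unfolding b mem_Collect_eq by (elim exE conjE)
      moreover have "tip (p', f', j', T', t @ [m]) = tip b @ [m]" by (simp add: b tip_def)
      ultimately show "m \<in> {m. \<exists>c. valid_state S L s c \<and> next_state S L b c \<and> tip c = tip b @ [m]}"
        unfolding mem_Collect_eq by (intro exI conjI)
    qed
  qed
  obtain L' where L': "laver_tree L'" "L' \<subseteq> L"
    and br: "\<And>y. y \<in> branches L' \<Longrightarrow> \<exists>\<alpha>. \<alpha> 0 = a \<and>
      (\<forall>n. valid_state S L s (\<alpha> n) \<and> next_state S L (\<alpha> n) (\<alpha> (Suc n)) \<and>
        tip (\<alpha> n) = map y [0..<length (tip a) + n])"
    by (rule laver_fusion[where tip = tip and Inv = "valid_state S L s" and step = "next_state S L",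
          OF tree a], erule tip_in, erule step, rule that)
  have "y \<in> coded_branch L s ` (dom_basic N f - (\<Union>j. S j))" if y: "y \<in> branches L'" for y
  proof -
    obtain \<alpha> where \<alpha>: "\<alpha> 0 = a" "\<And>n. next_state S L (\<alpha> n) (\<alpha> (Suc n))"
      "\<And>n. tip (\<alpha> n) = map y [0..<length (tip a) + n]"
      using br[OF y] by blast
    define p where "p n = fst (\<alpha> n)" for n
    define g where "g n = fst (snd (\<alpha> n))" for n
    define j where "j n = fst (snd (snd (\<alpha> n)))" for n
    define T where "T n = fst (snd (snd (snd (\<alpha> n))))" for n
    define t where "t n = tip (\<alpha> n)" for n
    have \<alpha>_eq: "\<alpha> n = (p n, g n, j n, T n, t n)" for n
      by (simp add: p_def g_def j_def T_def t_def tip_def)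
    have zero: "p 0 = initial_map f N" "g 0 = f" "j 0 = 0" "t 0 = walk L s f k"
      using \<alpha>(1) unfolding \<alpha>_eq a_def by auto
    have succ: "extends_above (g n) (p n) (p (Suc n))" "g n \<le> g (Suc n)"
      "\<exists>v. p (Suc n) (to_nat (t n)) = Some v \<and> t (Suc n) = child L (t n) v"
      "j (Suc n) = j n \<and> (T (Suc n), T n) \<in> immediate_subtree\<^sup>+ \<or>
       j (Suc n) = Suc (j n) \<and> {..<j n} \<subseteq> dom (p (Suc n)) \<and>
         cyl (p (Suc n)) (g (Suc n)) \<inter> S (j n) = {}" for n
      using \<alpha>(2)[of n] unfolding \<alpha>_eq by auto
    have ext_add: "extends_above (g n) (p n) (p (d + n)) \<and> g n \<le> g (d + n)" for n d
    proof (induction d)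
      case 0
      show ?case by (simp add: extends_above_refl)
    next
      case (Suc d)
      then show ?case
        using succ(1,2)[of "d + n"] extends_above_trans order_trans by (metis add_Suc)
    qed
    have ext: "extends_above (g n) (p n) (p m)" if "n \<le> m" for n m
      using ext_add[of n "m - n"] that by simp
    \<comment> \<open>While the index is unchanged the rank descends a well-founded
      relation.\<close>
    have jump: "\<exists>n'. j n' = i \<and> j (Suc n') = Suc i" if "j n = i" for n i
      using that
    proof (induction "T n" arbitrary: n rule: wf_induct_rule[OF wf_trancl[OF wf_immediate_subtree]])
      case (1 n)
      show ?case
      proof (cases "j (Suc n) = Suc (j n)")
        case True
        then show ?thesis using 1(2) by blast
      next
        case False
        then have "j (Suc n) = j n" "(T (Suc n), T n) \<in> immediate_subtree\<^sup>+"
          using succ(4)[of n] by auto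
        then show ?thesis using 1 by metis
      qed
    qed
    have reach: "\<exists>n. j n = i \<and> j (Suc n) = Suc i" for i
      by (induction i) (use zero(3) jump in blast)+
    have done_at: "\<exists>n. {..<i} \<subseteq> dom (p n) \<and> cyl (p n) (g n) \<inter> S i = {}" for i
    proof -
      obtain n where "j n = i" "j (Suc n) = Suc i" using reach by blast
      then show ?thesis using succ(4)[of n] by auto
    qed
    have "\<exists>n. c \<in> dom (p n)" for c using done_at[of "Suc c"] by blast
    then obtain \<nu> where \<nu>: "\<And>c. c \<in> dom (p (\<nu> c))" by metis
    \<comment> \<open>The union of the stems: they only grow, so the choice of stage is
      immaterial.\<close>
    define x where "x c = the (p (\<nu> c) c)" for c
    have x_eq: "p m c = Some (x c)" if "\<nu> c \<le> m" for c m
      using ext[OF that] \<nu>[of c] unfolding x_def extends_above_def map_le_def by force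
    have x_cyl: "x \<in> cyl (p n) (g n)" for n
    proof -
      have "case p n c of None \<Rightarrow> g n c \<le> x c | Some v \<Rightarrow> x c = v" for c
      proof -
        let ?m = "max n (\<nu> c)"
        have m: "extends_above (g n) (p n) (p ?m)" "p ?m c = Some (x c)"
          using ext x_eq by auto
        show ?thesis
        proof (cases "p n c")
          case None
          then show ?thesis using m by (auto simp: extends_above_def)
        next
          case (Some v)
          then have "p ?m c = Some v" using m(1) by (metis domI extends_above_def map_le_def)
          then show ?thesis using Some m(2) by simp
        qed
      qed
      then show ?thesis by (simp add: cyl_def)
    qed
    have x_p: "x c = v" if "p n c = Some v" for n c v
      using x_cyl[of n] that unfolding cyl_def by (metis (mono_tags, lifting) mem_Collect_eq option.simps(5))
    have x_basic: "x \<in> dom_basic N f"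
      using x_cyl[of 0] by (simp add: zero dom_basic_eq_cyl)
    have x_avoid: "x \<notin> S i" for i
      using done_at[of i] x_cyl by blast
    have "walk L s x (k + n) = t n" for n
    proof (induction n)
      case 0
      have "walk L s x k = walk L s f k"
        by (rule walk_cong) (use below x_basic in \<open>auto simp: dom_basic_def\<close>)
      then show ?case by (simp add: zero)
    next
      case (Suc n)
      obtain v where "p (Suc n) (to_nat (t n)) = Some v" "t (Suc n) = child L (t n) v"
        using succ(3) by blast
      then show ?case using Suc x_p by simp
    qed
    moreover have "t n = map y [0..<length s + k + n]" for n
      using \<alpha>(3)[of n] by (simp add: t_def a_def tip_def)
    ultimately have "coded_branch L s x = y"
      by (intro coded_branch_eqI[where k = k]) simp
    then show ?thesis using x_basic x_avoid by blast
  qed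
  then show thesis using that L' by blast
qed

section \<open>From the Baire property to measurability\<close>

lemma meager_inE:
  assumes "meager_in T A"
  obtains S where "\<And>j::nat. nowhere_dense_in T (S j)" "A \<subseteq> (\<Union>j. S j)"
proof -
  obtain F where F: "countable F" "\<And>B. B \<in> F \<Longrightarrow> nowhere_dense_in T B" "A \<subseteq> \<Union>F"
    using assms by (auto simp: meager_in_def)
  \<comment> \<open>The empty set is added so that the family can be enumerated even if
    empty.\<close>
  let ?S = "from_nat_into (insert {} F)"
  have "range ?S = insert {} F" using F(1) by (intro range_from_nat_into) auto
  moreover have "nowhere_dense_in T {}" by (simp add: nowhere_dense_in_def)
  ultimately have "nowhere_dense_in T (?S j)" for j using F(2) by (metis insertE rangeI)
  moreover have "A \<subseteq> (\<Union>j. ?S j)" using F(3) \<open>range ?S = insert {} F\<close> by simp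
  ultimately show thesis using that by blast
qed

theorem theorem3p4:
  fixes \<Gamma> :: "(nat \<Rightarrow> nat) set set"
  assumes "topologically_reasonable \<Gamma>"
    and "\<forall>A\<in>\<Gamma>. baire_property_in dominating_topology A"
  shows "\<forall>A\<in>\<Gamma>. laver_measurable A"
proof
  fix A assume A: "A \<in> \<Gamma>"
  show "laver_measurable A"
    unfolding laver_measurable_def
  proof (intro allI impI)
    fix L assume "laver_tree L"
    then obtain s where L: "laver_tree_stem L s" by (auto simp: laver_tree_def)
    let ?h = "coded_branch L s"
    have "?h -` A \<in> \<Gamma>"
      using assms(1) A continuous_on_coded_branch unfolding topologically_reasonable_def by blast
    then have "baire_property_in dominating_topology (?h -` A)" using assms(2) by blast
    then obtain U where U: "openin dominating_topology U"
      and "meager_in dominating_topology ((?h -` A - U) \<union> (U - ?h -` A))"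
      by (auto simp: baire_property_in_def)
    then obtain S where S: "\<And>j::nat. nowhere_dense_in dominating_topology (S j)"
      and sub: "(?h -` A - U) \<union> (U - ?h -` A) \<subseteq> (\<Union>j. S j)"
      using meager_inE by blast
    show "\<exists>L'. laver_tree L' \<and> L' \<subseteq> L \<and> (branches L' \<subseteq> A \<or> branches L' \<inter> A = {})"
    proof (cases "U = {}")
      case True
      \<comment> \<open>The preimage of \<open>A\<close> is meager here, so any basic set will do,
        for instance the whole space.\<close>
      obtain L' where "laver_tree L'" "L' \<subseteq> L" and br: "branches L' \<subseteq> ?h ` (dom_basic 0 (\<lambda>_. 0) - (\<Union>j. S j))"
        by (rule laver_tree_of_coded_generics[OF L S])
      moreover have "branches L' \<inter> A = {}" using br sub True by blast
      ultimately show ?thesis by blast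
    next
      case False
      then obtain N f where "dom_basic N f \<subseteq> U" using openin_dominatingE[OF U] by blast
      obtain L' where "laver_tree L'" "L' \<subseteq> L" and br: "branches L' \<subseteq> ?h ` (dom_basic N f - (\<Union>j. S j))"
        by (rule laver_tree_of_coded_generics[OF L S])
      \<comment> \<open>Points of \<open>U\<close> outside all \<open>S j\<close> are coded into
        \<open>A\<close>.\<close>
      moreover have "branches L' \<subseteq> A" using br sub \<open>dom_basic N f \<subseteq> U\<close> by blast
      ultimately show ?thesis by blast
    qed
  qed
qed

end
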